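(* Let $\mu$, $m$, $G_{2m}$, $\nu$, $z_1,\dots,z_{2m}$ be as in the context, let $n\ge 0$, and let $\mathcal P=\{p_0,p_1,\dots,p_{2m}\}$ be an admissible set of polynomials. For $w\in\mathbb C$ define $$Q_j(z,w):=p_j(z)\,K_{n+2m-j}(z,w;\mu),\qquad j=0,1,\dots,2m,$$ and the $(2m+1)\times(2m+1)$ matrix $$\boldsymbol Q(z,w)=\begin{pmatrix} Q_0(z,w)&Q_1(z,w)&\dots&Q_{2m}(z,w)\\ Q_0(z_1,w)&Q_1(z_1,w)&\dots&Q_{2m}(z_1,w)\\ \vdots&\vdots&\ddots&\vdots\\ Q_0(z_{2m},w)&Q_1(z_{2m},w)&\dots&Q_{2m}(z_{2m},w)\end{pmatrix}.$$ Then there exists a polynomial $C_n=C_n^{(\mathcal P)}$ of degree $\le (2m+1)(n+m)$ such that, for all $z,w\in\mathbb C$, $$\det\boldsymbol Q(z,w)=C_n(\overline w)\,G_{2m}(z)\,K_n(z,w;\nu).$$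
   Context: $\mathbb T=\{\zeta\in\mathbb C:|\zeta|=1\}$. $\mu$ is a nontrivial (i.e. with infinite support) positive finite Borel measure on $\mathbb T$. For such a measure, $\varphi_k(z;\mu)$, $k\ge0$, are the orthonormal polynomials ($\deg\varphi_k=k$, positive leading coefficient, $\int_{\mathbb T}\overline{\varphi_j(\zeta;\mu)}\varphi_k(\zeta;\mu)\,d\mu(\zeta)=\delta_{jk}$), and the Christoffel-Darboux (CD) kernel is $K_n(z,w;\mu)=\sum_{k=0}^n\overline{\varphi_k(w;\mu)}\,\varphi_k(z;\mu)$, $n\ge0$. $m\ge1$ is an integer and $G_{2m}$ is a polynomial of exact degree $2m$ that is self-reciprocal, i.e. $z^{2m}\overline{G_{2m}(1/\overline z)}=G_{2m}(z)$, and such that $G_{2m}(\zeta)/\zeta^m\ge0$ on $\operatorname{supp}(\mu)$. The positive measure $\nu$ on $\mathbb T$ is $d\nu(\zeta)=\frac{G_{2m}(\zeta)}{\zeta^m}\,d\mu(\zeta)=|G_{2m}(\zeta)|\,d\mu(\zeta)$, with CD kernels $K_n(z,w;\nu)$. The zeros of $G_{2m}$ (with multiplicity) are $z_1,\dots,z_{2m}$. Admissible set: a set $\mathcal P=\{p_0,\dots,p_{2m}\}$ of $2m+1$ not identically zero polynomials is admissible if $p_0\equiv1$, $p_{2m}(z)=z^m$, for $1\le j\le 2m-1$ one has $p_j(z)=\sum_{i=\max\{0,j-m\}}^{\min\{j,m\}}b_{ij}z^i$ with complex $b_{ij}$, and at least one of the following three conditions holds: (A1) $\deg p_j<j$ for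 $j=1,\dots,2m$; (A2) $\deg p_j<m$ for $j=1,\dots,2m-1$; (A3) $p_j(0)=0$ for $j=1,\dots,2m$. *)

theory Defs
  imports
    "HOL-Analysis.Analysis"
    "HOL-Computational_Algebra.Polynomial"
    "Jordan_Normal_Form.Determinant"
begin

abbreviation unit_circle :: "complex set" where
  "unit_circle \<equiv> sphere 0 1"

definition circle_supp :: "complex measure \<Rightarrow> complex set" where
  "circle_supp M =
     {\<zeta> \<in> unit_circle. \<forall>U. open U \<longrightarrow> \<zeta> \<in> U \<longrightarrow> emeasure M (U \<inter> unit_circle) > 0}"

definition nontrivial_circle_measure :: "complex measure \<Rightarrow> bool" where
  "nontrivial_circle_measure M \<longleftrightarrow>
     sets M = sets (restrict_space borel unit_circle) \<and>
     finite_measure M \<and> infinite (circle_supp M)"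

definition orthonormal_polys :: "complex measure \<Rightarrow> (nat \<Rightarrow> complex poly) \<Rightarrow> bool" where
  "orthonormal_polys M \<phi> \<longleftrightarrow>
     (\<forall>k. degree (\<phi> k) = k \<and> lead_coeff (\<phi> k) \<in> \<real> \<and> Re (lead_coeff (\<phi> k)) > 0) \<and>
     (\<forall>j k. (LINT \<zeta>|M. cnj (poly (\<phi> j) \<zeta>) * poly (\<phi> k) \<zeta>) = (if j = k then 1 else 0))"

text \<open>For a nontrivial measure the orthonormal polynomials exist and are unique
  (Gram-Schmidt applied to the monomials), so the description below is proper in that case.\<close>

definition orthonormal_poly :: "complex measure \<Rightarrow> nat \<Rightarrow> complex poly" where
  "orthonormal_poly M = (THE \<phi>. orthonormal_polys M \<phi>)"

definition CD_kernel :: "nat \<Rightarrow> complex \<Rightarrow> complex \<Rightarrow> complex measure \<Rightarrow> complex" where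
  "CD_kernel n z w M =
     (\<Sum>k=0..n. cnj (poly (orthonormal_poly M k) w) * poly (orthonormal_poly M k) z)"

definition self_reciprocal :: "nat \<Rightarrow> complex poly \<Rightarrow> bool" where
  "self_reciprocal d G \<longleftrightarrow> (\<forall>z. z \<noteq> 0 \<longrightarrow> z ^ d * cnj (poly G (1 / cnj z)) = poly G z)"

text \<open>The measure \<open>\<bar>G\<bar> d\<mu>\<close>; if \<open>G \<zeta> / \<zeta> ^ m \<ge> 0\<close> on the support of \<open>\<mu>\<close>, then
  \<open>\<bar>G \<zeta>\<bar> = G \<zeta> / \<zeta> ^ m\<close> there, because \<open>\<bar>\<zeta>\<bar> = 1\<close>.\<close>

definition modified_measure :: "complex poly \<Rightarrow> complex measure \<Rightarrow> complex measure" where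
  "modified_measure G M = density M (\<lambda>\<zeta>. ennreal (cmod (poly G \<zeta>)))"

text \<open>Only the members \<open>p 0, \<dots>, p (2 * m)\<close> of the family matter. In the lower summation
  bound, truncated subtraction gives \<open>max {0, j - m}\<close>.\<close>

definition admissible :: "nat \<Rightarrow> (nat \<Rightarrow> complex poly) \<Rightarrow> bool" where
  "admissible m p \<longleftrightarrow>
     (\<forall>j\<in>{0..2*m}. p j \<noteq> 0) \<and>
     p 0 = 1 \<and> p (2*m) = monom 1 m \<and>
     (\<exists>b :: nat \<Rightarrow> nat \<Rightarrow> complex. \<forall>j\<in>{1..2*m-1}.
        p j = (\<Sum>i = j - m..min j m. monom (b i j) i)) \<and>
     ((\<forall>j\<in>{1..2*m}. degree (p j) < j) \<or>
      (\<forall>j\<in>{1..2*m-1}. degree (p j) < m) \<or>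
      (\<forall>j\<in>{1..2*m}. poly (p j) 0 = 0))"

definition Q_fun ::
  "nat \<Rightarrow> (nat \<Rightarrow> complex poly) \<Rightarrow> complex measure \<Rightarrow> nat \<Rightarrow> nat \<Rightarrow> complex \<Rightarrow> complex \<Rightarrow> complex"
where
  "Q_fun m p M n j z w = poly (p j) z * CD_kernel (n + 2*m - j) z w M"

text \<open>Row 0 is evaluated at \<open>z\<close>, row \<open>i \<ge> 1\<close> at the node \<open>zs i\<close>.\<close>

definition Q_mat ::
  "nat \<Rightarrow> (nat \<Rightarrow> complex poly) \<Rightarrow> complex measure \<Rightarrow> (nat \<Rightarrow> complex) \<Rightarrow> nat
     \<Rightarrow> complex \<Rightarrow> complex \<Rightarrow> complex Matrix.mat"
where
  "Q_mat m p M zs n z w =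
     Matrix.mat (2*m+1) (2*m+1) (\<lambda>(i, j). Q_fun m p M n j (if i = 0 then z else zs i) w)"

end

(* For fixed w, expanding det Q along its first row shows that det Q(z, w) is a polynomial of degree
   at most n + 2m in z which vanishes at the zeros of G, hence equals G(z) q(z) with deg q <= n.
   On the unit circle, conj(zeta^m f(zeta)) p_j(zeta) is the conjugate of a polynomial of degree
   at most n + 2m - j whenever deg f <= n, so the reproducing property of the kernels of mu
   gives <f, q> = conj(f(w)) C(conj w) in L^2(nu), where C is the determinant obtained
   from Q by replacing its first row with the reversed polynomials of the p_j.
   Hence q = C(conj w) K_n(., w; nu). If G has a multiple zero, two rows of Q coincide and C = 0. *)

theory Submission
  imports Defs
begin

section \<open>Polynomial spans and reversal\<close>

text \<open>Triangularity: cancel the top coefficient with the last basis element and induct.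
  Vanishing coefficients instead of \<open>degree f < n\<close> let \<open>n = 0\<close> mean
  \<open>f = 0\<close>, which is the base case.\<close>

lemma poly_as_combination:
  fixes \<phi> :: "nat \<Rightarrow> complex poly"
  assumes "\<And>k. k < n \<Longrightarrow> degree (\<phi> k) = k \<and> \<phi> k \<noteq> 0"
    and "\<And>i. i \<ge> n \<Longrightarrow> poly.coeff f i = 0"
  shows "\<exists>c. f = (\<Sum>k<n. Polynomial.smult (c k) (\<phi> k))"
  using assms
proof (induction n arbitrary: f)
  case 0
  then show ?case by (auto simp: poly_eq_iff)
next
  case (Suc n)
  define a where "a = poly.coeff f n / lead_coeff (\<phi> n)"
  have deg: "degree (\<phi> n) = n" and nz: "\<phi> n \<noteq> 0"
    using Suc.prems(1)[OF lessI] by blast+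
  have "\<exists>c. f - Polynomial.smult a (\<phi> n) = (\<Sum>k<n. Polynomial.smult (c k) (\<phi> k))"
  proof (rule Suc.IH)
    fix i assume "n \<le> i"
    show "poly.coeff (f - Polynomial.smult a (\<phi> n)) i = 0"
    proof (cases "i = n")
      case True
      moreover have "poly.coeff (\<phi> n) n \<noteq> 0" using nz deg by (metis leading_coeff_0_iff)
      ultimately show ?thesis using deg by (simp add: a_def)
    next
      case False
      then have "Suc n \<le> i" using \<open>n \<le> i\<close> by simp
      then show ?thesis using Suc.prems(2)[of i] deg by (simp add: coeff_eq_0)
    qed
  qed (rule Suc.prems(1), simp)
  then obtain c where c: "f - Polynomial.smult a (\<phi> n) = (\<Sum>k<n. Polynomial.smult (c k) (\<phi> k))" by blast
  have "f = (\<Sum>k<n. Polynomial.smult (c k) (\<phi> k)) + Polynomial.smult a (\<phi> n)"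
    using c by (simp add: algebra_simps)
  also have "\<dots> = (\<Sum>k<Suc n. Polynomial.smult ((c(n := a)) k) (\<phi> k))"
    by simp
  finally show ?case by blast
qed

text \<open>With \<open>q\<close> the reversal of \<open>p\<close> in degree \<open>m\<close>, the polynomial \<open>map_poly cnj q\<close> is the
  reciprocal polynomial of \<open>p\<close>.\<close>

definition rev_poly :: "nat \<Rightarrow> complex poly \<Rightarrow> complex poly" where
  "rev_poly m p = (\<Sum>i\<le>m. monom (poly.coeff p i) (m - i))"

text \<open>On the unit circle \<open>cnj \<zeta>\<close> inverts \<open>\<zeta>\<close>, so the
  factor \<open>cnj \<zeta> ^ m\<close> turns each power \<open>\<zeta> ^ i\<close> into
  \<open>cnj \<zeta> ^ (m - i)\<close>.\<close>

lemma poly_rev_poly_cnj: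
  assumes "degree p \<le> m" "cmod \<zeta> = 1"
  shows "poly (rev_poly m p) (cnj \<zeta>) = cnj \<zeta> ^ m * poly p \<zeta>"
proof -
  have one: "cnj \<zeta> * \<zeta> = 1"
    using complex_norm_square[of \<zeta>] assms(2) by (simp add: mult.commute)
  have "poly p \<zeta> = (\<Sum>i\<le>m. poly.coeff p i * \<zeta> ^ i)"
    unfolding poly_altdef
    by (rule sum.mono_neutral_left) (use assms(1) in \<open>auto simp: coeff_eq_0\<close>)
  moreover have "cnj \<zeta> ^ m * \<zeta> ^ i = cnj \<zeta> ^ (m - i)" if "i \<le> m" for i
  proof -
    have "cnj \<zeta> ^ m * \<zeta> ^ i = cnj \<zeta> ^ (m - i) * (cnj \<zeta> * \<zeta>) ^ i"
      using that by (simp add: power_mult_distrib flip: power_add mult.assoc)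
    then show ?thesis using one by simp
  qed
  ultimately show ?thesis
    by (auto simp: rev_poly_def poly_sum poly_monom sum_distrib_left mult.left_commute
        intro!: sum.cong)
qed

text \<open>Reversal sends low-order coefficients to the top, so a zero of order \<open>d\<close> at
  the origin becomes a drop in degree.\<close>

lemma degree_rev_poly_le:
  assumes "\<And>i. i < d \<Longrightarrow> poly.coeff p i = 0"
  shows "degree (rev_poly m p) \<le> m - d"
  unfolding rev_poly_def
proof (rule degree_sum_le)
  fix i assume "i \<in> {..m}"
  show "degree (monom (poly.coeff p i) (m - i)) \<le> m - d"
  proof (cases "i < d")
    case False
    then show ?thesis by (intro order_trans[OF degree_monom_le]) simp
  qed (use assms in auto)
qed simp

section \<open>Determinants\<close>

text \<open>Each term of the Leibniz expansion takes exactly one entry from every column.\<close>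

lemma degree_det_le_sum_columns:
  fixes A :: "'a::comm_ring_1 poly Matrix.mat"
  assumes "A \<in> carrier_mat n n"
    and deg: "\<And>i j. i < n \<Longrightarrow> j < n \<Longrightarrow> degree (A $$ (i, j)) \<le> d j"
  shows "degree (Determinant.det A) \<le> (\<Sum>j<n. d j)"
  unfolding det_def'[OF assms(1)]
proof (rule degree_sum_le)
  fix \<pi> assume "\<pi> \<in> {\<pi>. \<pi> permutes {0..<n}}"
  then have \<pi>: "\<pi> permutes {0..<n}" by simp
  have "degree (\<Prod>i = 0..<n. A $$ (i, \<pi> i)) \<le> (\<Sum>i = 0..<n. degree (A $$ (i, \<pi> i)))"
    using degree_prod_sum_le[of "{0..<n}" "\<lambda>i. A $$ (i, \<pi> i)"] by (simp add: o_def)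
  also have "\<dots> \<le> (\<Sum>i = 0..<n. d (\<pi> i))"
    using permutes_in_image[OF \<pi>] by (intro sum_mono deg) auto
  also have "\<dots> = (\<Sum>j<n. d j)"
    using sum.permute[OF \<pi>, of d] by (simp add: o_def atLeast0LessThan)
  finally have "degree (\<Prod>i = 0..<n. A $$ (i, \<pi> i)) \<le> (\<Sum>j<n. d j)" .
  moreover have "degree (signof \<pi> :: 'a poly) = 0"
    by (simp add: sign_def)
  ultimately show "degree (signof \<pi> * (\<Prod>i = 0..<n. A $$ (i, \<pi> i))) \<le> (\<Sum>j<n. d j)"
    using degree_mult_le[of "signof \<pi>" "\<Prod>i = 0..<n. A $$ (i, \<pi> i)"] by linarith
qed (simp add: finite_permutations)

text \<open>Row \<open>i\<close> is deleted in forming these cofactors. This lets matrices with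
  different first rows share one set of expansion coefficients.\<close>

lemma cofactor_cong_row:
  assumes "A \<in> carrier_mat n n" "B \<in> carrier_mat n n"
    and "\<And>k j. k < n \<Longrightarrow> j < n \<Longrightarrow> k \<noteq> i \<Longrightarrow> A $$ (k, j) = B $$ (k, j)"
  shows "cofactor A i j = cofactor B i j"
proof -
  have "mat_delete A i j = mat_delete B i j"
    using assms by (intro eq_matI) (auto simp: mat_delete_def)
  then show ?thesis by (simp add: cofactor_def)
qed

section \<open>Orthonormal polynomials on the unit circle\<close>

definition poly_inner :: "complex measure \<Rightarrow> complex poly \<Rightarrow> complex poly \<Rightarrow> complex" where
  "poly_inner M f g = (LINT \<zeta>|M. cnj (poly f \<zeta>) * poly g \<zeta>)"

locale circle_measure = finite_measure M for M :: "complex measure" +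
  assumes sets_M: "sets M = sets (restrict_space borel unit_circle)"
begin

section \<open>Integration of polynomials over the circle\<close>

lemma space_M: "space M = unit_circle"
  using sets_eq_imp_space_eq[OF sets_M] by (simp add: space_restrict_space)

lemma measurable_continuous_on:
  fixes g :: "complex \<Rightarrow> 'b::topological_space"
  assumes "continuous_on unit_circle g"
  shows "g \<in> borel_measurable M"
  using borel_measurable_continuous_on_restrict[OF assms] measurable_cong_sets[OF sets_M refl]
  by blast

text \<open>The circle is compact, so the integrand is bounded, and the measure is finite.\<close>

lemma integrable_continuous_on:
  fixes g :: "complex \<Rightarrow> 'b::{banach,second_countable_topology}"
  assumes "continuous_on unit_circle g"
  shows "integrable M g"
proof -
  have "bounded (g ` unit_circle)"
    using assms by (intro compact_imp_bounded compact_continuous_image) auto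
  then obtain B where "\<forall>x\<in>unit_circle. norm (g x) \<le> B"
    unfolding bounded_iff by blast
  then show ?thesis
    using measurable_continuous_on[OF assms] space_M
    by (intro integrable_const_bound[of _ B]) auto
qed

lemma integrable_poly_inner: "integrable M (\<lambda>\<zeta>. cnj (poly f \<zeta>) * poly g \<zeta>)"
  by (intro integrable_continuous_on continuous_intros)

lemma poly_inner_sum_right:
  "poly_inner M f (\<Sum>i\<in>A. Polynomial.smult (c i) (g i)) = (\<Sum>i\<in>A. c i * poly_inner M f (g i))"
proof -
  have "poly_inner M f (\<Sum>i\<in>A. Polynomial.smult (c i) (g i))
      = (LINT \<zeta>|M. (\<Sum>i\<in>A. c i * (cnj (poly f \<zeta>) * poly (g i) \<zeta>)))"
    by (simp add: poly_inner_def poly_sum sum_distrib_left mult.left_commute)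
  also have "\<dots> = (\<Sum>i\<in>A. LINT \<zeta>|M. c i * (cnj (poly f \<zeta>) * poly (g i) \<zeta>))"
    by (intro Bochner_Integration.integral_sum integrable_mult_right integrable_poly_inner)
  also have "\<dots> = (\<Sum>i\<in>A. c i * poly_inner M f (g i))"
    by (simp add: poly_inner_def)
  finally show ?thesis .
qed

lemma poly_inner_diff_right: "poly_inner M f (g - h) = poly_inner M f g - poly_inner M f h"
  using Bochner_Integration.integral_diff[OF integrable_poly_inner integrable_poly_inner]
  by (simp add: poly_inner_def right_diff_distrib)

lemma poly_inner_smult_right: "poly_inner M f (Polynomial.smult c g) = c * poly_inner M f g"
  using poly_inner_sum_right[of f "\<lambda>_. c" "\<lambda>_. g" "{()}"] by simp

lemma cnj_poly_inner: "cnj (poly_inner M f g) = poly_inner M g f"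
  by (simp add: poly_inner_def mult.commute flip: Bochner_Integration.integral_cnj)

lemma poly_inner_smult_left: "poly_inner M (Polynomial.smult c f) g = cnj c * poly_inner M f g"
  using arg_cong[OF poly_inner_smult_right[of g c f], of cnj] by (simp add: cnj_poly_inner)

lemma poly_inner_sum_left:
  "poly_inner M (\<Sum>i\<in>A. Polynomial.smult (c i) (f i)) g = (\<Sum>i\<in>A. cnj (c i) * poly_inner M (f i) g)"
  using arg_cong[OF poly_inner_sum_right[of g c f A], of cnj] by (simp add: cnj_poly_inner)

section \<open>Norms, the support and vanishing integrals\<close>

lemma poly_inner_self: "poly_inner M f f = complex_of_real (LINT \<zeta>|M. (cmod (poly f \<zeta>))\<^sup>2)"
  unfolding poly_inner_def integral_complex_of_real[symmetric]
  by (intro Bochner_Integration.integral_cong refl)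
    (simp only: complex_norm_square mult.commute)

text \<open>Off the support every point of the circle has an open neighbourhood of measure zero. The
  Lindeloef property leaves countably many of these, and their union is null.\<close>

lemma AE_in_circle_supp: "AE \<zeta> in M. \<zeta> \<in> circle_supp M"
proof -
  define \<F> where "\<F> = {U. open U \<and> emeasure M (U \<inter> unit_circle) = 0}"
  have "open U" if "U \<in> \<F>" for U using that by (simp add: \<F>_def)
  then obtain \<F>' where \<F>': "\<F>' \<subseteq> \<F>" "countable \<F>'" "\<Union>\<F>' = \<Union>\<F>"
    by (rule Lindelof)
  have "U \<inter> unit_circle \<in> null_sets M" if "U \<in> \<F>'" for U
  proof (rule null_setsI)
    have "open U" "emeasure M (U \<inter> unit_circle) = 0" using that \<F>'(1) by (auto simp: \<F>_def)
    then show "emeasure M (U \<inter> unit_circle) = 0" "U \<inter> unit_circle \<in> sets M"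
      unfolding sets_M sets_restrict_space by (auto simp: Int_commute)
  qed
  then have "(\<Union>U\<in>\<F>'. U \<inter> unit_circle) \<in> null_sets M"
    using \<F>'(2) by (intro null_sets_UN') auto
  moreover have "{\<zeta> \<in> space M. \<zeta> \<notin> circle_supp M} \<subseteq> (\<Union>U\<in>\<F>'. U \<inter> unit_circle)"
  proof
    fix \<zeta> assume "\<zeta> \<in> {\<zeta> \<in> space M. \<zeta> \<notin> circle_supp M}"
    then have "\<zeta> \<in> unit_circle" "\<zeta> \<in> \<Union>\<F>"
      by (auto simp: space_M circle_supp_def \<F>_def)
    then show "\<zeta> \<in> (\<Union>U\<in>\<F>'. U \<inter> unit_circle)"
      unfolding \<F>'(3)[symmetric] by blast
  qed
  ultimately show ?thesis by (rule AE_I')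
qed

text \<open>By continuity a nonzero value at a support point persists on a neighbourhood, which has
  positive mass; but a nonnegative integrand with zero integral vanishes almost everywhere.\<close>

lemma integral_eq_0_imp_eq_0_on_supp:
  fixes g :: "complex \<Rightarrow> real"
  assumes cont: "continuous_on UNIV g" and nonneg: "\<And>x. g x \<ge> 0"
    and int: "(LINT x|M. g x) = 0" and \<zeta>: "\<zeta> \<in> circle_supp M"
  shows "g \<zeta> = 0"
proof (rule ccontr)
  assume "g \<zeta> \<noteq> 0"
  have AE: "AE x in M. g x = 0"
    using integral_nonneg_eq_0_iff_AE[of M g] int nonneg
      integrable_continuous_on[OF continuous_on_subset[OF cont]] by auto
  define U where "U = {x. g x \<noteq> 0}"
  have "open U"
    unfolding U_def by (rule open_Collect_neq[OF cont continuous_on_const])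
  moreover have "\<zeta> \<in> U" using \<open>g \<zeta> \<noteq> 0\<close> by (simp add: U_def)
  ultimately have "emeasure M (U \<inter> unit_circle) > 0"
    using \<zeta> by (auto simp: circle_supp_def)
  moreover have "U \<inter> unit_circle \<in> sets M"
    unfolding sets_M sets_restrict_space using \<open>open U\<close> by auto
  ultimately show False
    using AE_E2[OF AE] space_M
    by (auto simp: U_def Int_def conj_commute)
qed

end

section \<open>Existence and uniqueness of orthonormal polynomials\<close>

locale definite_circle_measure = circle_measure +
  assumes definite: "poly_inner M f f = 0 \<Longrightarrow> f = 0"
begin

text \<open>Describes one member of the orthonormal sequence without the others, by orthogonality to
  all polynomials of degree below \<open>k\<close>, so that each \<open>k\<close> can be treated
  separately. For \<open>k = 0\<close> the condition on \<open>f\<close> leaves only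
  \<open>f = 0\<close>.\<close>

definition is_orthonormal_poly :: "nat \<Rightarrow> complex poly \<Rightarrow> bool" where
  "is_orthonormal_poly k P \<longleftrightarrow>
     degree P = k \<and> lead_coeff P \<in> \<real> \<and> Re (lead_coeff P) > 0 \<and> poly_inner M P P = 1 \<and>
     (\<forall>f. (\<forall>i\<ge>k. poly.coeff f i = 0) \<longrightarrow> poly_inner M f P = 0)"

lemma is_orthonormal_poly_degree:
  "is_orthonormal_poly k P \<Longrightarrow> degree P = k \<and> P \<noteq> 0"
  by (auto simp: is_orthonormal_poly_def)

lemma is_orthonormal_poly_inner:
  assumes "is_orthonormal_poly i P" "is_orthonormal_poly j Q" "i \<noteq> j"
  shows "poly_inner M P Q = 0"
proof -
  have less: "poly_inner M P Q = 0"
    if "is_orthonormal_poly i P" "is_orthonormal_poly j Q" "i < j" for i j P Q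
    using that unfolding is_orthonormal_poly_def by (metis coeff_eq_0 order_less_le_trans)
  show ?thesis
  proof (cases "i < j")
    case False
    then have "poly_inner M Q P = 0" using less[OF assms(2,1)] assms(3) by simp
    then show ?thesis using cnj_poly_inner[of Q P] by simp
  qed (use less assms in blast)
qed

text \<open>Gram-Schmidt: \<open>T\<close> is the monomial minus its projection onto the earlier
  polynomials, and is then normalised.\<close>

lemma ex_is_orthonormal_poly: "\<exists>P. is_orthonormal_poly k P"
proof (induction k rule: less_induct)
  case (less k)
  then obtain \<phi> where \<phi>: "\<And>j. j < k \<Longrightarrow> is_orthonormal_poly j (\<phi> j)" by metis
  define T where "T = monom 1 k - (\<Sum>j<k. Polynomial.smult (poly_inner M (\<phi> j) (monom 1 k)) (\<phi> j))"
  have coeff: "poly.coeff (\<phi> j) i = 0" if "j < k" "i \<ge> k" for i j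
    using is_orthonormal_poly_degree[OF \<phi>[OF that(1)]] that by (intro coeff_eq_0) auto
  have T_coeff: "poly.coeff T i = (if i = k then 1 else 0)" if "i \<ge> k" for i
    using that by (simp add: T_def coeff_sum coeff)
  have T_deg: "degree T = k"
    using T_coeff by (intro antisym degree_le le_degree) auto
  have T_lead: "lead_coeff T = 1" using T_coeff T_deg by simp
  have orth: "poly_inner M (\<phi> i) T = 0" if "i < k" for i
  proof -
    have "poly_inner M (\<phi> i) (\<phi> j) = (if j = i then 1 else 0)" if "j < k" for j
      using is_orthonormal_poly_inner[OF \<phi>[OF \<open>i < k\<close>] \<phi>[OF that]] \<phi>[OF that]
      by (auto simp: is_orthonormal_poly_def)
    then have "(\<Sum>j<k. poly_inner M (\<phi> j) (monom 1 k) * poly_inner M (\<phi> i) (\<phi> j))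
        = (\<Sum>j<k. if j = i then poly_inner M (\<phi> i) (monom 1 k) else 0)"
      by (intro sum.cong) auto
    then show ?thesis
      using that by (simp add: T_def poly_inner_diff_right poly_inner_sum_right)
  qed
  have orth': "poly_inner M f T = 0" if f: "\<forall>i\<ge>k. poly.coeff f i = 0" for f
  proof -
    obtain c where "f = (\<Sum>j<k. Polynomial.smult (c j) (\<phi> j))"
      using poly_as_combination[of k \<phi> f] is_orthonormal_poly_degree \<phi> f by blast
    then show ?thesis by (simp add: poly_inner_sum_left orth)
  qed
  define s where "s = (LINT \<zeta>|M. (cmod (poly T \<zeta>))\<^sup>2)"
  have inner_T: "poly_inner M T T = complex_of_real s"
    by (simp add: s_def poly_inner_self)
  \<comment> \<open>Definiteness makes the squared norm \<open>s\<close> of the monic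
    \<open>T\<close> positive; the positive real factor \<open>1 / sqrt s\<close> then normalises
    \<open>T\<close> and keeps its leading coefficient positive.\<close>
  have "T \<noteq> 0" using T_lead by auto
  then have "s \<noteq> 0" using definite[of T] inner_T by auto
  moreover have "s \<ge> 0" unfolding s_def by simp
  ultimately have "s > 0" by simp
  define a where "a = 1 / sqrt s"
  have a: "a > 0" "a * a * s = 1" using \<open>s > 0\<close> by (auto simp: a_def)
  have "poly_inner M (Polynomial.smult (of_real a) T) (Polynomial.smult (of_real a) T) = of_real (a * a * s)"
    by (simp add: poly_inner_smult_left poly_inner_smult_right inner_T)
  then have "is_orthonormal_poly k (Polynomial.smult (of_real a) T)"
    using a T_deg T_lead orth'
    by (simp add: is_orthonormal_poly_def poly_inner_smult_right)
  then show ?case by blast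
qed

text \<open>Matching leading coefficients gives a difference \<open>D\<close> of degree below
  \<open>k\<close>, hence orthogonal to both polynomials and so to itself. Equal norms and positive
  leading coefficients then force the ratio to be 1.\<close>

lemma is_orthonormal_poly_unique:
  assumes "is_orthonormal_poly k P" "is_orthonormal_poly k Q"
  shows "P = Q"
proof -
  obtain a b where a: "lead_coeff P = complex_of_real a" "a > 0"
    and b: "lead_coeff Q = complex_of_real b" "b > 0"
    using assms by (auto simp: is_orthonormal_poly_def elim!: Reals_cases)
  define D where "D = P - Polynomial.smult (of_real (a / b)) Q"
  have deg: "degree P = k" "degree Q = k"
    using assms by (auto simp: is_orthonormal_poly_def)
  have "poly.coeff D i = 0" if "i \<ge> k" for i
  proof (cases "i = k")
    case True
    then show ?thesis using a b deg by (simp add: D_def)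
  next
    case False
    then show ?thesis using that deg by (simp add: D_def coeff_eq_0)
  qed
  then have "poly_inner M D P = 0" "poly_inner M D Q = 0"
    using assms by (auto simp: is_orthonormal_poly_def)
  then have "poly_inner M D D = 0"
    by (simp add: D_def poly_inner_diff_right poly_inner_smult_right)
  then have "D = 0" by (rule definite)
  then have P: "P = Polynomial.smult (of_real (a / b)) Q" by (simp add: D_def)
  have "poly_inner M P P = of_real (a / b * (a / b)) * poly_inner M Q Q"
    unfolding P poly_inner_smult_left poly_inner_smult_right by simp
  then have "(of_real (a / b * (a / b)) :: complex) = 1"
    using assms by (simp add: is_orthonormal_poly_def)
  then have "(a / b)\<^sup>2 = 1" by (simp only: of_real_eq_1_iff power2_eq_square)
  moreover have "a / b > 0" using a b by simp
  ultimately have "a / b = 1" unfolding power2_eq_1_iff by linarith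
  then show ?thesis using P by simp
qed

text \<open>The first \<open>k\<close> members of an orthonormal sequence span all polynomials of
  degree below \<open>k\<close>, so pairwise orthogonality amounts to orthogonality to that whole
  space.\<close>

lemma orthonormal_polys_iff: "orthonormal_polys M \<phi> \<longleftrightarrow> (\<forall>k. is_orthonormal_poly k (\<phi> k))"
proof
  assume \<phi>: "orthonormal_polys M \<phi>"
  then have inner: "poly_inner M (\<phi> j) (\<phi> k) = (if j = k then 1 else 0)" for j k
    by (simp add: orthonormal_polys_def poly_inner_def)
  show "\<forall>k. is_orthonormal_poly k (\<phi> k)"
  proof
    fix k
    have "poly_inner M f (\<phi> k) = 0" if f: "\<forall>i\<ge>k. poly.coeff f i = 0" for f
    proof -
      have "\<And>j. degree (\<phi> j) = j \<and> \<phi> j \<noteq> 0"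
        using \<phi> by (metis orthonormal_polys_def leading_coeff_0_iff less_irrefl zero_complex.sel(1))
      then obtain c where "f = (\<Sum>j<k. Polynomial.smult (c j) (\<phi> j))"
        using poly_as_combination[of k \<phi> f] f by blast
      then show ?thesis by (simp add: poly_inner_sum_left inner)
    qed
    then show "is_orthonormal_poly k (\<phi> k)"
      using \<phi> inner unfolding is_orthonormal_poly_def orthonormal_polys_def by metis
  qed
next
  assume \<phi>: "\<forall>k. is_orthonormal_poly k (\<phi> k)"
  then have "poly_inner M (\<phi> j) (\<phi> k) = (if j = k then 1 else 0)" for j k
    using is_orthonormal_poly_inner[of j "\<phi> j" k "\<phi> k"]
    by (cases "j = k") (metis is_orthonormal_poly_def, simp)
  then show "orthonormal_polys M \<phi>"
    using \<phi> unfolding orthonormal_polys_def poly_inner_def is_orthonormal_poly_def by blast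
qed

text \<open>Existence and uniqueness for each \<open>k\<close> yield exactly one sequence, so the
  definite description in \<open>orthonormal_poly\<close> denotes it.\<close>

lemma is_orthonormal_poly_orthonormal_poly: "is_orthonormal_poly k (orthonormal_poly M k)"
proof -
  have "\<exists>!\<phi>. orthonormal_polys M \<phi>"
    unfolding orthonormal_polys_iff using ex_is_orthonormal_poly is_orthonormal_poly_unique
    by (metis ext)
  then have "orthonormal_polys M (orthonormal_poly M)"
    unfolding orthonormal_poly_def by (rule theI')
  then show ?thesis by (simp add: orthonormal_polys_iff)
qed

lemma degree_orthonormal_poly: "degree (orthonormal_poly M k) = k"
  and orthonormal_poly_nonzero: "orthonormal_poly M k \<noteq> 0"
  using is_orthonormal_poly_degree[OF is_orthonormal_poly_orthonormal_poly] by auto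

lemma poly_inner_orthonormal_poly:
  "poly_inner M (orthonormal_poly M j) (orthonormal_poly M k) = (if j = k then 1 else 0)"
  using is_orthonormal_poly_inner[OF is_orthonormal_poly_orthonormal_poly
      is_orthonormal_poly_orthonormal_poly, of j k] is_orthonormal_poly_orthonormal_poly[of k]
  by (simp add: is_orthonormal_poly_def)

section \<open>Fourier expansion and Christoffel-Darboux kernels\<close>

lemma orthonormal_expansion:
  assumes "degree f \<le> n"
  shows "f = (\<Sum>k\<le>n. Polynomial.smult (poly_inner M (orthonormal_poly M k) f) (orthonormal_poly M k))"
proof -
  obtain c where c: "f = (\<Sum>k<Suc n. Polynomial.smult (c k) (orthonormal_poly M k))"
    using poly_as_combination[of "Suc n" "orthonormal_poly M" f] assms
      degree_orthonormal_poly orthonormal_poly_nonzero by (auto simp: coeff_eq_0)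
  have "poly_inner M (orthonormal_poly M k) f = c k" if "k \<le> n" for k
  proof -
    have "(\<Sum>j\<le>n. c j * (if k = j then 1 else 0)) = c k"
      using that by (simp add: if_distrib cong: if_cong)
    then show ?thesis
      by (subst c) (simp add: poly_inner_sum_right poly_inner_orthonormal_poly lessThan_Suc_atMost
          del: sum.lessThan_Suc)
  qed
  then show ?thesis
    using c by (simp add: lessThan_Suc_atMost del: sum.lessThan_Suc)
qed

text \<open>The kernel as a polynomial object in its first variable, so that degrees and
  divisibility can be discussed for fixed \<open>w\<close>.\<close>

definition CD_poly :: "nat \<Rightarrow> complex \<Rightarrow> complex poly" where
  "CD_poly n w = (\<Sum>k\<le>n. Polynomial.smult (cnj (poly (orthonormal_poly M k) w)) (orthonormal_poly M k))"

lemma poly_CD_poly: "poly (CD_poly n w) z = CD_kernel n z w M"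
  by (simp add: CD_poly_def CD_kernel_def poly_sum atMost_atLeast0)

lemma degree_CD_poly_le: "degree (CD_poly n w) \<le> n"
  unfolding CD_poly_def
  by (rule degree_sum_le) (auto intro: order_trans[OF degree_smult_le] simp: degree_orthonormal_poly)

text \<open>The reproducing property, from the Fourier expansion of \<open>f\<close>; it holds at
  every complex \<open>w\<close>, on or off the circle. The value is conjugated because the first
  slot is conjugate-linear.\<close>

lemma poly_inner_CD_poly:
  assumes "degree f \<le> n"
  shows "poly_inner M f (CD_poly n w) = cnj (poly f w)"
proof -
  have "poly_inner M f (CD_poly n w)
      = (\<Sum>k\<le>n. cnj (poly_inner M (orthonormal_poly M k) f * poly (orthonormal_poly M k) w))"
    by (simp add: CD_poly_def poly_inner_sum_right cnj_poly_inner mult.commute)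
  also have "\<dots> = cnj (poly f w)"
    by (subst (2) orthonormal_expansion[OF assms]) (simp add: poly_sum)
  finally show ?thesis .
qed

text \<open>Testing against the orthonormal polynomials reads off the Fourier coefficients of
  \<open>q\<close>. There is no division by \<open>c\<close>, so \<open>c = 0\<close> is
  covered.\<close>

lemma CD_kernel_eqI:
  assumes "degree q \<le> n"
    and "\<And>f. degree f \<le> n \<Longrightarrow> poly_inner M f q = cnj (poly f w) * c"
  shows "poly q z = c * CD_kernel n z w M"
proof -
  have "poly q z = (\<Sum>k\<le>n. poly_inner M (orthonormal_poly M k) q * poly (orthonormal_poly M k) z)"
    by (subst orthonormal_expansion[OF assms(1)]) (simp add: poly_sum)
  also have "\<dots> = c * CD_kernel n z w M"
    unfolding CD_kernel_def sum_distrib_left atMost_atLeast0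
    by (intro sum.cong) (auto simp: assms(2) degree_orthonormal_poly)
  finally show ?thesis .
qed

text \<open>The kernel is antiholomorphic in its second variable \<open>w\<close>; this is its
  dependence on \<open>cnj w\<close> as a polynomial, for fixed \<open>z\<close>.\<close>

definition CD_poly_cnj :: "nat \<Rightarrow> complex \<Rightarrow> complex poly" where
  "CD_poly_cnj n z = (\<Sum>k\<le>n. Polynomial.smult (poly (orthonormal_poly M k) z)
                              (map_poly cnj (orthonormal_poly M k)))"

lemma poly_CD_poly_cnj: "poly (CD_poly_cnj n z) (cnj w) = CD_kernel n z w M"
  by (simp add: CD_poly_cnj_def CD_kernel_def poly_sum atMost_atLeast0 mult.commute)

lemma degree_CD_poly_cnj_le: "degree (CD_poly_cnj n z) \<le> n"
  unfolding CD_poly_cnj_def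
proof (rule degree_sum_le)
  fix k assume "k \<in> {..n}"
  then show "degree (Polynomial.smult (poly (orthonormal_poly M k) z) (map_poly cnj (orthonormal_poly M k))) \<le> n"
    using degree_smult_le[of "poly (orthonormal_poly M k) z" "map_poly cnj (orthonormal_poly M k)"]
      map_poly_degree_leq[of cnj "orthonormal_poly M k"] degree_orthonormal_poly[of k]
    by simp
qed simp

end

section \<open>The modified measure\<close>

lemma poly_eq_0_if_infinite_zeros:
  fixes f :: "complex poly"
  assumes "infinite S" "\<And>x. x \<in> S \<Longrightarrow> poly f x = 0"
  shows "f = 0"
  using assms poly_roots_finite[of f] by (metis (mono_tags, lifting) finite_subset mem_Collect_eq subsetI)

text \<open>A polynomial of norm zero vanishes on the support, which is infinite.\<close>

lemma nontrivial_imp_definite: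
  assumes "nontrivial_circle_measure M"
  shows "definite_circle_measure M"
proof -
  interpret circle_measure M
    using assms by (simp add: nontrivial_circle_measure_def circle_measure_def circle_measure_axioms_def)
  show ?thesis
  proof
    fix f assume "poly_inner M f f = 0"
    then have "(LINT \<zeta>|M. (cmod (poly f \<zeta>))\<^sup>2) = 0" by (simp add: poly_inner_self)
    moreover have "continuous_on UNIV (\<lambda>\<zeta>. (cmod (poly f \<zeta>))\<^sup>2)"
      by (intro continuous_intros)
    ultimately have "poly f \<zeta> = 0" if "\<zeta> \<in> circle_supp M" for \<zeta>
      using integral_eq_0_imp_eq_0_on_supp[of "\<lambda>\<zeta>. (cmod (poly f \<zeta>))\<^sup>2" \<zeta>] that by simp
    then show "f = 0"
      using assms poly_eq_0_if_infinite_zeros by (auto simp: nontrivial_circle_measure_def)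
  qed
qed

context circle_measure
begin

lemma integral_modified_measure:
  fixes g :: "complex \<Rightarrow> 'b::{banach,second_countable_topology}"
  assumes "continuous_on unit_circle g"
  shows "(LINT \<zeta>|modified_measure G M. g \<zeta>) = (LINT \<zeta>|M. cmod (poly G \<zeta>) *\<^sub>R g \<zeta>)"
  unfolding modified_measure_def
  by (rule integral_density) (auto intro!: measurable_continuous_on continuous_intros assms)

lemma circle_measure_modified: "circle_measure (modified_measure G M)"
proof -
  have int: "integrable M (\<lambda>\<zeta>. cmod (poly G \<zeta>))"
    by (intro integrable_continuous_on continuous_intros)
  have "emeasure (modified_measure G M) (space M) = (\<integral>\<^sup>+\<zeta>. ennreal (cmod (poly G \<zeta>)) \<partial>M)"
    unfolding modified_measure_def
    by (subst emeasure_density)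
      (auto intro!: measurable_continuous_on measurable_compose[OF _ measurable_ennreal]
        continuous_intros nn_integral_cong)
  also have "\<dots> = ennreal (LINT \<zeta>|M. cmod (poly G \<zeta>))"
    using int by (intro nn_integral_eq_integral) auto
  finally have "finite_measure (modified_measure G M)"
    by (intro finite_measureI) (simp add: modified_measure_def)
  then show ?thesis
    by (simp add: circle_measure_def circle_measure_axioms_def modified_measure_def sets_M)
qed

end

text \<open>A polynomial \<open>f\<close> of norm zero makes \<open>G * f\<close> vanish on the
  infinite support of \<open>M\<close>; polynomials have no zero divisors. The support of the
  modified measure never has to be determined.\<close>

lemma definite_modified_measure:
  assumes M: "nontrivial_circle_measure M" and "G \<noteq> 0"
  shows "definite_circle_measure (modified_measure G M)"
proof -
  interpret definite_circle_measure M by (rule nontrivial_imp_definite[OF M])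
  interpret N: circle_measure "modified_measure G M" by (rule circle_measure_modified)
  show ?thesis
  proof
    fix f assume "poly_inner (modified_measure G M) f f = 0"
    then have "(LINT \<zeta>|M. cmod (poly G \<zeta>) * (cmod (poly f \<zeta>))\<^sup>2) = 0"
      by (simp add: N.poly_inner_self integral_modified_measure continuous_intros)
    moreover have "continuous_on UNIV (\<lambda>\<zeta>. cmod (poly G \<zeta>) * (cmod (poly f \<zeta>))\<^sup>2)"
      by (intro continuous_intros)
    ultimately have "poly (G * f) \<zeta> = 0" if "\<zeta> \<in> circle_supp M" for \<zeta>
      using integral_eq_0_imp_eq_0_on_supp
          [of "\<lambda>\<zeta>. cmod (poly G \<zeta>) * (cmod (poly f \<zeta>))\<^sup>2" \<zeta>] that
      by simp
    then have "G * f = 0"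
      using M poly_eq_0_if_infinite_zeros[of "circle_supp M" "G * f"]
      unfolding nontrivial_circle_measure_def by blast
    then show "f = 0" using \<open>G \<noteq> 0\<close> by simp
  qed
qed

text \<open>On the circle dividing by \<open>\<zeta> ^ m\<close> is multiplying by its conjugate, so
  positivity reads \<open>cnj (\<zeta> ^ m) * poly G \<zeta> = cmod (poly G \<zeta>)\<close>. The
  conjugated power moves into the first slot as a monomial.\<close>

lemma (in circle_measure) poly_inner_modified_measure:
  assumes pos: "\<forall>\<zeta>\<in>circle_supp M. poly G \<zeta> / \<zeta> ^ m \<in> \<real>\<^sub>\<ge>\<^sub>0"
  shows "poly_inner (modified_measure G M) f q = poly_inner M (monom 1 m * f) (G * q)"
proof -
  have *: "cnj (\<zeta> ^ m) * poly G \<zeta> = complex_of_real (cmod (poly G \<zeta>))"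
    if "\<zeta> \<in> circle_supp M" for \<zeta>
  proof -
    have norm: "cmod \<zeta> = 1" using that by (simp add: circle_supp_def)
    then have "cnj (\<zeta> ^ m) * \<zeta> ^ m = 1"
      using complex_norm_square[of "\<zeta> ^ m"] by (simp add: mult.commute norm_power)
    moreover have "\<zeta> ^ m \<noteq> 0" using norm by auto
    ultimately have "1 / \<zeta> ^ m = cnj (\<zeta> ^ m)"
      by (subst nonzero_divide_eq_eq) simp_all
    then have "poly G \<zeta> * (1 / \<zeta> ^ m) = cnj (\<zeta> ^ m) * poly G \<zeta>"
      by (simp only: mult.commute)
    then have eq: "poly G \<zeta> / \<zeta> ^ m = cnj (\<zeta> ^ m) * poly G \<zeta>"
      by (simp only: times_divide_eq_right mult_1_right)
    have "poly G \<zeta> / \<zeta> ^ m \<in> \<real>\<^sub>\<ge>\<^sub>0" using pos that by blast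
    then obtain r where r: "poly G \<zeta> / \<zeta> ^ m = complex_of_real r" "r \<ge> 0"
      by (rule nonneg_Reals_cases)
    then have "cmod (poly G \<zeta> / \<zeta> ^ m) = r" by simp
    then have "cmod (poly G \<zeta>) = r" using norm by (simp add: norm_divide norm_power)
    then show ?thesis using r eq by simp
  qed
  have "poly_inner (modified_measure G M) f q
      = (LINT \<zeta>|M. cmod (poly G \<zeta>) *\<^sub>R (cnj (poly f \<zeta>) * poly q \<zeta>))"
    unfolding poly_inner_def by (intro integral_modified_measure continuous_intros)
  also have "\<dots> = poly_inner M (monom 1 m * f) (G * q)"
    unfolding poly_inner_def
  \<comment> \<open>Positivity is known on the support only, so the integrands are compared almost
    everywhere.\<close>
  proof (rule integral_cong_AE)
    show "AE \<zeta> in M. cmod (poly G \<zeta>) *\<^sub>R (cnj (poly f \<zeta>) * poly q \<zeta>)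
        = cnj (poly (monom 1 m * f) \<zeta>) * poly (G * q) \<zeta>"
      using AE_in_circle_supp
    proof eventually_elim
      case (elim \<zeta>)
      have "cnj (poly (monom 1 m * f) \<zeta>) * poly (G * q) \<zeta>
          = (cnj (\<zeta> ^ m) * poly G \<zeta>) * (cnj (poly f \<zeta>) * poly q \<zeta>)"
        by (simp add: poly_monom mult_ac)
      then show ?case by (simp only: *[OF elim] scaleR_conv_of_real)
    qed
  qed (intro measurable_continuous_on continuous_intros)+
  finally show ?thesis .
qed

text \<open>On the circle \<open>cnj (\<zeta> ^ m)\<close> times \<open>p\<close> is the conjugate
  of the reciprocal polynomial \<open>r\<close> of \<open>p\<close>. The degree hypothesis keeps
  \<open>f * r\<close> within reach of the reproducing property of the kernel of index
  \<open>N\<close>.\<close>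

lemma (in definite_circle_measure) poly_inner_mult_CD_poly:
  assumes "degree p \<le> m" and "degree f + degree (rev_poly m p) \<le> N"
  shows "poly_inner M (monom 1 m * f) (p * CD_poly N w)
       = cnj (poly f w) * poly (rev_poly m p) (cnj w)"
proof -
  define r where "r = map_poly cnj (rev_poly m p)"
  have deg: "degree (f * r) \<le> N"
    using degree_mult_le[of f r] map_poly_degree_leq[of cnj "rev_poly m p"] assms(2)
    by (simp add: r_def)
  have "poly_inner M (monom 1 m * f) (p * CD_poly N w) = poly_inner M (f * r) (CD_poly N w)"
    unfolding poly_inner_def
  proof (intro Bochner_Integration.integral_cong refl)
    fix \<zeta> assume "\<zeta> \<in> space M"
    then have "cmod \<zeta> = 1" by (simp add: space_M)
    then show "cnj (poly (monom 1 m * f) \<zeta>) * poly (p * CD_poly N w) \<zeta>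
        = cnj (poly (f * r) \<zeta>) * poly (CD_poly N w) \<zeta>"
      by (simp add: r_def poly_rev_poly_cnj[OF assms(1)] poly_monom mult_ac)
  qed
  also have "\<dots> = cnj (poly (f * r) w)" by (rule poly_inner_CD_poly[OF deg])
  finally show ?thesis by (simp add: r_def)
qed

section \<open>The determinantal formula\<close>

text \<open>The prescribed end members \<open>1\<close> and \<open>monom 1 m\<close> fit the same
  band of exponents as the middle ones, which gives one statement for all indices.\<close>

lemma admissible_coeff:
  assumes "admissible m p" "j \<le> 2 * m" "i < j - m \<or> i > min j m"
  shows "poly.coeff (p j) i = 0"
proof -
  obtain b :: "nat \<Rightarrow> nat \<Rightarrow> complex" where
    b: "\<forall>j\<in>{1..2*m-1}. p j = (\<Sum>i = j - m..min j m. monom (b i j) i)"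
    using assms(1) by (auto simp: admissible_def)
  consider "j = 0" | "j = 2 * m" | "j \<in> {1..2*m-1}"
    using assms(2) by fastforce
  then show ?thesis
  proof cases
    case 1
    then show ?thesis using assms by (simp add: admissible_def coeff_eq_0)
  next
    case 2
    then show ?thesis using assms by (auto simp: admissible_def)
  next
    case 3
    then show ?thesis using b assms(3) by (auto simp: coeff_sum intro!: sum.neutral)
  qed
qed

text \<open>The remainder \<open>R mod G\<close> vanishes at \<open>degree G\<close> distinct points
  but has smaller degree.\<close>

lemma dvd_by_distinct_roots:
  fixes G R :: "complex poly"
  assumes "S \<subseteq> {x. poly G x = 0}" "card S = degree G" "G \<noteq> 0"
    and "\<And>x. x \<in> S \<Longrightarrow> poly R x = 0"
  shows "G dvd R"
proof -
  have "R mod G = 0"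
  proof (cases "degree G = 0")
    case True
    then show ?thesis using assms(3) by (metis degree_mod_less less_nat_zero_code)
  next
    case False
    show ?thesis
    proof (rule poly_eqI_degree[of S])
      fix x assume "x \<in> S"
      then have "poly G x = 0" "poly R x = 0" using assms by auto
      moreover have "poly R x = poly (R div G) x * poly G x + poly (R mod G) x"
        by (metis div_mult_mod_eq poly_add poly_mult)
      ultimately show "poly (R mod G) x = poly 0 x" by simp
    next
      show "degree (R mod G) < card S" "degree (0 :: complex poly) < card S"
        using degree_mod_less[OF assms(3), of R] False assms(2) by auto
    qed
  qed
  then show ?thesis by auto
qed

theorem theorem1p1:
  fixes \<mu> \<nu> :: "complex measure" and m n :: nat and G :: "complex poly"
    and zs :: "nat \<Rightarrow> complex" and p :: "nat \<Rightarrow> complex poly"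
  assumes "nontrivial_circle_measure \<mu>"
    and "m \<ge> 1"
    and "degree G = 2 * m"
    and "self_reciprocal (2 * m) G"
    and "\<forall>\<zeta>\<in>circle_supp \<mu>. poly G \<zeta> / \<zeta> ^ m \<in> \<real>\<^sub>\<ge>\<^sub>0"
    and "\<nu> = modified_measure G \<mu>"
    and "image_mset zs (mset_set {1..2*m}) = proots G"
    and "admissible m p"
  shows "\<exists>C :: complex poly. degree C \<le> (2 * m + 1) * (n + m) \<and>
           (\<forall>z w. Determinant.det (Q_mat m p \<mu> zs n z w) =
                    poly C (cnj w) * poly G z * CD_kernel n z w \<nu>)"
proof -
  interpret definite_circle_measure \<mu> by (rule nontrivial_imp_definite[OF assms(1)])
  have G0: "G \<noteq> 0" using assms(2,3) by auto
  interpret N: definite_circle_measure \<nu>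
    unfolding assms(6) by (rule definite_modified_measure[OF assms(1) G0])
  have Q_carrier: "Q_mat m p \<mu> zs n z w \<in> carrier_mat (2*m+1) (2*m+1)" for z w
    by (simp add: Q_mat_def)
  show ?thesis
  proof (cases "inj_on zs {1..2*m}")
    case False
    then obtain i k where ik: "i \<in> {1..2*m}" "k \<in> {1..2*m}" "i \<noteq> k" "zs i = zs k"
      by (auto simp: inj_on_def)
    have "Determinant.det (Q_mat m p \<mu> zs n z w) = 0" for z w
    proof (rule det_identical_rows[OF Q_carrier \<open>i \<noteq> k\<close>])
      show "Matrix.row (Q_mat m p \<mu> zs n z w) i = Matrix.row (Q_mat m p \<mu> zs n z w) k"
        using ik by (intro eq_vecI) (auto simp: Q_mat_def)
    qed (use ik in auto)
    then show ?thesis by (intro exI[of _ 0]) simp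
  next
    case True
    have roots: "zs ` {1..2*m} = {x. poly G x = 0}"
      using arg_cong[OF assms(7), of set_mset] G0 by simp
    \<comment> \<open>The entries are polynomials in \<open>cnj w\<close>. At \<open>cnj w\<close>
      the rows below the first become those of \<open>Q_mat\<close>, which do not involve
      \<open>z\<close>, so \<open>C\<close> depends on neither \<open>z\<close> nor
      \<open>w\<close>.\<close>
    define B where "B = Matrix.mat (2*m+1) (2*m+1) (\<lambda>(i, j). if i = 0 then rev_poly m (p j)
        else Polynomial.smult (poly (p j) (zs i)) (CD_poly_cnj (n + 2*m - j) (zs i)))"
    define C where "C = Determinant.det B"
    have B_carrier: "B \<in> carrier_mat (2*m+1) (2*m+1)" by (simp add: B_def)
    have deg_p: "degree (p j) \<le> min j m" if "j \<le> 2*m" for j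
      using admissible_coeff[OF assms(8) that] by (intro degree_le) auto
    \<comment> \<open>For \<open>j > m\<close> the exponents of \<open>p j\<close> start at
      \<open>j - m\<close> and \<open>m - (j - m) = 2*m - j\<close>; for \<open>j \<le> m\<close>
      the trivial bound \<open>m\<close> suffices.\<close>
    have deg_rev: "degree (rev_poly m (p j)) \<le> 2*m - j" if "j \<le> 2*m" for j
      using degree_rev_poly_le[of "j - m" "p j" m] admissible_coeff[OF assms(8) that] by fastforce
    have "degree C \<le> (\<Sum>j<2*m+1. n + 2*m - j)"
      unfolding C_def
    proof (rule degree_det_le_sum_columns[OF B_carrier])
      fix i j assume ij: "i < 2*m+1" "j < 2*m+1"
      show "degree (B $$ (i, j)) \<le> n + 2*m - j"
        using ij deg_rev[of j] degree_CD_poly_cnj_le[of "n + 2*m - j" "zs i"]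
        by (auto simp: B_def)
    qed
    also have "(\<Sum>j<2*m+1. n + 2*m - j) = (\<Sum>j<2*m+1. n + j)"
      by (rule sum.reindex_bij_witness[of _ "\<lambda>j. 2*m - j" "\<lambda>j. 2*m - j"]) auto
    also have "\<dots> = (2*m+1) * (n + m)"
      by (simp add: sum.distrib lessThan_Suc_atMost atMost_atLeast0 gauss_sum_nat algebra_simps)
    finally have deg_C: "degree C \<le> (2*m+1) * (n + m)" .
    have "Determinant.det (Q_mat m p \<mu> zs n z w) = poly C (cnj w) * poly G z * CD_kernel n z w \<nu>"
      for z w
    proof -
      \<comment> \<open>These cofactors omit row 0 and hence do not depend on \<open>z\<close>, so
        \<open>R\<close> represents the determinant at every first argument.\<close>
      define c where "c j = cofactor (Q_mat m p \<mu> zs n z w) 0 j" for j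
      define R where "R = (\<Sum>j<2*m+1. Polynomial.smult (c j) (p j * CD_poly (n + 2*m - j) w))"
      have det_R: "Determinant.det (Q_mat m p \<mu> zs n x w) = poly R x" for x
      proof -
        have "cofactor (Q_mat m p \<mu> zs n x w) 0 j = c j" for j
          unfolding c_def by (rule cofactor_cong_row[OF Q_carrier Q_carrier]) (simp add: Q_mat_def)
        then show ?thesis
          unfolding laplace_expansion_row[OF Q_carrier, of 0, simplified]
          by (auto simp: R_def poly_sum Q_mat_def Q_fun_def poly_CD_poly mult_ac intro!: sum.cong)
      qed
      have C_eq: "poly C (cnj w) = (\<Sum>j<2*m+1. c j * poly (rev_poly m (p j)) (cnj w))"
      proof -
        \<comment> \<open>Evaluation at \<open>cnj w\<close> is a ring homomorphism and commutes
          with the determinant. The evaluated matrix agrees with \<open>Q_mat\<close> below the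
          first row, so its cofactors are again \<open>c j\<close>.\<close>
        interpret ev: comm_ring_hom "\<lambda>f :: complex poly. poly f (cnj w)"
          by unfold_locales auto
        let ?B = "map_mat (\<lambda>f. poly f (cnj w)) B"
        have carrier: "?B \<in> carrier_mat (2*m+1) (2*m+1)" using B_carrier by simp
        have cofactor_B: "cofactor ?B 0 j = c j" for j
          unfolding c_def
          by (rule cofactor_cong_row[OF carrier Q_carrier])
            (simp add: Q_mat_def B_def Q_fun_def poly_CD_poly_cnj)
        have row_B: "?B $$ (0, j) = poly (rev_poly m (p j)) (cnj w)" if "j < 2*m+1" for j
          using that by (simp add: B_def)
        have "Determinant.det ?B = (\<Sum>j<2*m+1. ?B $$ (0, j) * cofactor ?B 0 j)"
          by (rule laplace_expansion_row[OF carrier]) simp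
        also have "\<dots> = (\<Sum>j<2*m+1. c j * poly (rev_poly m (p j)) (cnj w))"
          by (intro sum.cong refl) (simp only: lessThan_iff cofactor_B row_B mult.commute)
        finally show ?thesis by (simp only: C_def ev.hom_det)
      qed
      have "G dvd R"
      proof (rule dvd_by_distinct_roots[of "zs ` {1..2*m}"])
        show "card (zs ` {1..2*m}) = degree G"
          using card_image[OF True] assms(3) by simp
        fix x assume "x \<in> zs ` {1..2*m}"
        then obtain i where i: "i \<in> {1..2*m}" "x = zs i" by auto
        \<comment> \<open>At a node the first row repeats the row of that node.\<close>
        have "Determinant.det (Q_mat m p \<mu> zs n x w) = 0"
        proof (rule det_identical_rows[OF Q_carrier, of 0 i])
          show "Matrix.row (Q_mat m p \<mu> zs n x w) 0 = Matrix.row (Q_mat m p \<mu> zs n x w) i"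
            using i by (intro eq_vecI) (auto simp: Q_mat_def)
        qed (use i in auto)
        then show "poly R x = 0" by (simp add: det_R)
      qed (use roots G0 in auto)
      then obtain q where q: "R = G * q" by blast
      have "degree R \<le> n + 2*m"
        unfolding R_def
      proof (rule degree_sum_le)
        fix j assume "j \<in> {..<2*m+1}"
        \<comment> \<open>The degree of \<open>p j\<close> is at most \<open>j\<close>, exactly the
          amount by which the kernel index drops.\<close>
        then have "degree (p j) + degree (CD_poly (n + 2*m - j) w) \<le> n + 2*m"
          using deg_p[of j] degree_CD_poly_le[of "n + 2*m - j" w] by simp arith
        then show "degree (Polynomial.smult (c j) (p j * CD_poly (n + 2*m - j) w)) \<le> n + 2*m"
          by (meson degree_mult_le degree_smult_le order_trans)
      qed simp
      then have "degree q \<le> n"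
        using q G0 assms(3) by (cases "q = 0") (auto simp: degree_mult_eq)
      moreover have "poly_inner \<nu> f q = cnj (poly f w) * poly C (cnj w)" if f: "degree f \<le> n" for f
      proof -
        have "poly_inner \<nu> f q = poly_inner \<mu> (monom 1 m * f) R"
          unfolding assms(6) q by (rule poly_inner_modified_measure[OF assms(5)])
        also have "\<dots> = (\<Sum>j<2*m+1. c j * (cnj (poly f w) * poly (rev_poly m (p j)) (cnj w)))"
          unfolding R_def poly_inner_sum_right
        proof (intro sum.cong refl)
          \<comment> \<open>\<open>degree f \<le> n\<close> and the reversal bound
            \<open>2*m - j\<close> add up to at most the kernel index \<open>n + 2*m - j\<close> of
            column \<open>j\<close>.\<close>
          fix j assume j: "j \<in> {..<2*m+1}"
          then show "c j * poly_inner \<mu> (monom 1 m * f) (p j * CD_poly (n + 2*m - j) w)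
              = c j * (cnj (poly f w) * poly (rev_poly m (p j)) (cnj w))"
            using deg_p[of j] deg_rev[of j] f by (subst poly_inner_mult_CD_poly) auto
        qed
        also have "\<dots> = cnj (poly f w) * poly C (cnj w)"
          unfolding C_eq sum_distrib_left by (simp only: mult.left_commute)
        finally show ?thesis .
      qed
      ultimately have "poly q z = poly C (cnj w) * CD_kernel n z w \<nu>"
        by (rule N.CD_kernel_eqI)
      then show ?thesis by (simp add: det_R q mult_ac)
    qed
    then show ?thesis using deg_C by blast
  qed
qed

end
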